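(* Let $(G,K)$ be one of the following pairs, with $K$ embedded in $G$ as a maximal compact subgroup in the usual way: (1) $G=GL_{m}(\mathbb{R})$, $K=O(m)$; (2) $G=GL_{m}(\mathbb{C})$, $K=U(m)$; (3) $G=GL_{m}(\mathbb{H})$, $K=Sp(m)$; (4) $G=O_{p}(\mathbb{C})$, $K=O(p)$; (5) $G=O(p,q)$, $K=O(p)\times O(q)$; (6) $G=Sp(p,q)$, $K=Sp(p)\times Sp(q)$; (7) $G=U(p,q)$, $K=U(p)\times U(q)$; (8) $G=Sp_{2n}(\mathbb{C})$, $K=Sp(n)$; (9) $G=Sp_{2n}(\mathbb{R})$, $K=U(n)$; (10) $G=O^{*}(2n)$, $K=U(n)$. Let $\mathfrak{g}$ be the complexified Lie algebra of $G$. If $\pi$ is an irreducible $(\mathfrak{g},K)$-module and $\sigma_{1},\sigma_{2}\in\mathcal{R}(K,\pi)$, then $\varepsilon(\sigma_{1})=\varepsilon(\sigma_{2})$, where $\varepsilon:\mathcal{R}(K)\to\mathbb{Z}/2\mathbb{Z}$ is the parity of $K$-types.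
   Context: A $K$-type is an equivalence class of irreducible continuous $K$-modules (automatically finite-dimensional and unitary); $\mathcal{R}(K)$ is the set of $K$-types. For a $(\mathfrak{g},K)$-module $V$, $\mathcal{R}(K,V)$ is the set of $K$-types $\sigma$ occurring in $V$, i.e. with $\mathrm{Hom}_{K}(\sigma,V)\neq0$. $[t]$ denotes the greatest integer $\le t$. Parametrization of $K$-types. $K=U(n)$: with the diagonal maximal torus $U(1)^{n}$ and positive roots $\{e_{i}-e_{j}: i<j\}$, a $U(n)$-type is parametrized by its highest weight $(a_{1},\dots,a_{n})$, integers $a_{1}\geqslant\cdots\geqslant a_{n}$. $K=Sp(n)$ (compact): with the standard maximal torus $U(1)^{n}$ and positive roots $\{e_{i}\pm e_{j}: i<j\}\cup\{2e_{i}\}$, an $Sp(n)$-type is parametrized by its highest weight $(a_{1},\dots,a_{n})$, integers $a_{1}\geqslant\cdots\geqslant a_{n}\geqslant0$. $K=O(n)$: embed $O(n)=U(n)\cap GL(n,\mathbb{R})$. There is a bijection (Weyl) between $\mathcal{R}(O(n))$ and the set of $U(n)$-types with highest weight $(b_{1},\dots,b_{r},\underbrace{1,\dots,1}_{s},\underbrace{0,\dots,0}_{n-r-s})$, $b_{r}\geqslant2$, $2r+s\leqslant n$; the $O(n)$-type $\sigma$ corresponds to the $U(n)$-type $\lambda$ when the highest weight vectors of $\lambda$ generate an $O(n)$-module equivalent to $\sigma$. Here highest weight vectors are taken with respect to a Borel subgroup of $GL_{n}(\mathbb{C})$ stabilizing a complete flag $F_{1}\subset\cdots\subset F_{n}=\mathbb{C}^{n}$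 with $F_{n-i}=F_{i}^{\perp}$ for the complex bilinear form preserved by $O(n)$. An $O(n)$-type is then parametrized as $(a_{1},\dots,a_{[n/2]};\epsilon)$ with integers $a_{1}\geqslant\cdots\geqslant a_{[n/2]}\geqslant0$ and $\epsilon\in\{\pm1\}$: if $x=|\{i:a_{i}>0\}|$, the corresponding $U(n)$-type is $(a_{1},\dots,a_{x},\underbrace{1,\dots,1}_{\frac{1-\epsilon}{2}(n-2x)},0,\dots,0)$. When $n=2x$ the two choices of $\epsilon$ give the same $O(n)$-type; otherwise the parametrization is unique. Parity. For $K=U(n)$ or $Sp(n)$ and $\sigma=(a_{1},\dots,a_{n})$, $\varepsilon(\sigma)=\sum_{i=1}^{n}a_{i}\pmod 2$. For $K=O(n)$ and $\sigma=(a_{1},\dots,a_{[n/2]};\epsilon)$, $\varepsilon(\sigma)=\sum_{i=1}^{[n/2]}a_{i}+\frac{1-\epsilon}{2}\cdot n\pmod 2$ (well defined). For a product $K=K_{1}\times\cdots\times K_{r}$ with each $K_{i}$ one of $U(n_{i}),Sp(n_{i}),O(n_{i})$, and $\sigma=\bigotimes_{i}\sigma_{i}$ with $\sigma_i\in\mathcal{R}(K_i)$, $\varepsilon(\sigma)=\sum_{i=1}^{r}\varepsilon(\sigma_{i})\in\mathbb{Z}/2\mathbb{Z}$. *)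

theory Defs
  imports
    "HOL-Analysis.Derivative"
    "HOL-Analysis.Function_Topology"
    "HOL-Library.Z2"
    "Jordan_Normal_Form.VS_Connect"
    "Jordan_Normal_Form.Schur_Decomposition"
begin

section \<open>Matrix groups and their Lie algebras\<close>

definition GL :: "nat \<Rightarrow> complex mat set" where
  "GL n = {A \<in> carrier_mat n n. invertible_mat A}"

definition real_mat :: "complex mat \<Rightarrow> bool" where
  "real_mat A \<longleftrightarrow> elements_mat A \<subseteq> \<real>"

abbreviation cnj_mat :: "complex mat \<Rightarrow> complex mat" where
  "cnj_mat \<equiv> map_mat cnj"

text \<open>The entries outside the format of a matrix are cut off, so that on matrices of one fixed
  format this is the usual topology.\<close>

definition mat_topology :: "complex mat set \<Rightarrow> complex mat topology" where
  "mat_topology S = pullback_topology S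
     (\<lambda>A ij. if fst ij < dim_row A \<and> snd ij < dim_col A then A $$ ij else 0) euclidean"

definition mat_exp :: "complex mat \<Rightarrow> complex mat" where
  "mat_exp A = Matrix.mat (dim_row A) (dim_row A) (\<lambda>ij. \<Sum>k. (A ^\<^sub>m k) $$ ij / fact k)"

definition one_param :: "complex mat \<Rightarrow> real \<Rightarrow> complex mat" where
  "one_param X t = mat_exp (complex_of_real t \<cdot>\<^sub>m X)"

text \<open>The real Lie algebra of a closed subgroup of the general linear group of rank \<open>n\<close>.\<close>

definition lie_algebra :: "nat \<Rightarrow> complex mat set \<Rightarrow> complex mat set" where
  "lie_algebra n G = {X \<in> carrier_mat n n. \<forall>t. one_param X t \<in> G}"

definition bracket :: "complex mat \<Rightarrow> complex mat \<Rightarrow> complex mat" where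
  "bracket X Y = X * Y - Y * X"

text \<open>The abstract complexification of a real Lie algebra of matrices: the pair \<open>(X, Y)\<close> stands
  for \<open>X \<otimes> 1 + Y \<otimes> \<i>\<close>. The real Lie algebra may itself consist of complex matrices (and even be
  a complex subspace), so the complexification must not be formed inside the matrices.\<close>

definition cx_carrier :: "complex mat set \<Rightarrow> (complex mat \<times> complex mat) set" where
  "cx_carrier L = L \<times> L"

fun cx_add :: "complex mat \<times> complex mat \<Rightarrow> complex mat \<times> complex mat \<Rightarrow> complex mat \<times> complex mat" where
  "cx_add (X, Y) (X', Y') = (X + X', Y + Y')"

fun cx_scale :: "complex \<Rightarrow> complex mat \<times> complex mat \<Rightarrow> complex mat \<times> complex mat" where
  "cx_scale c (X, Y) =
     (complex_of_real (Re c) \<cdot>\<^sub>m X - complex_of_real (Im c) \<cdot>\<^sub>m Y,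
      complex_of_real (Re c) \<cdot>\<^sub>m Y + complex_of_real (Im c) \<cdot>\<^sub>m X)"

fun cx_bracket :: "complex mat \<times> complex mat \<Rightarrow> complex mat \<times> complex mat \<Rightarrow> complex mat \<times> complex mat" where
  "cx_bracket (X, Y) (X', Y') =
     (bracket X X' - bracket Y Y', bracket X Y' + bracket Y X')"


section \<open>Modules over a Lie algebra and a compact group\<close>

text \<open>\<open>G\<close> is a group of matrices of size \<open>N\<close> and \<open>K\<close> a compact subgroup of it. \<open>V\<close> carries no
  topology: continuity and differentiability of orbit maps, which lie in finite-dimensional
  subspaces by \<open>K_finite\<close>, are expressed by linear functionals. In \<open>K_Ad\<close>, \<open>k'\<close> is the inverse
  of \<open>k\<close>.\<close>

locale gK_module = vector_space smul
  for smul :: "complex \<Rightarrow> 'v::ab_group_add \<Rightarrow> 'v" +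
  fixes N :: nat
    and G K :: "complex mat set"
    and act :: "complex mat \<times> complex mat \<Rightarrow> 'v \<Rightarrow> 'v"
    and kact :: "complex mat \<Rightarrow> 'v \<Rightarrow> 'v"
  assumes act_linear: "Z \<in> cx_carrier (lie_algebra N G) \<Longrightarrow> Vector_Spaces.linear smul smul (act Z)"
    and act_add: "Z \<in> cx_carrier (lie_algebra N G) \<Longrightarrow> W \<in> cx_carrier (lie_algebra N G) \<Longrightarrow>
          act (cx_add Z W) v = act Z v + act W v"
    and act_scale: "Z \<in> cx_carrier (lie_algebra N G) \<Longrightarrow> act (cx_scale c Z) v = smul c (act Z v)"
    and act_bracket: "Z \<in> cx_carrier (lie_algebra N G) \<Longrightarrow> W \<in> cx_carrier (lie_algebra N G) \<Longrightarrow>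
          act (cx_bracket Z W) v = act Z (act W v) - act W (act Z v)"
    and kact_linear: "k \<in> K \<Longrightarrow> Vector_Spaces.linear smul smul (kact k)"
    and kact_one: "kact (1\<^sub>m N) v = v"
    and kact_mult: "h \<in> K \<Longrightarrow> k \<in> K \<Longrightarrow> kact (h * k) v = kact h (kact k v)"
    and K_finite: "\<exists>B. finite B \<and> (\<lambda>k. kact k v) ` K \<subseteq> span B"
    and K_continuous: "Vector_Spaces.linear smul (*) \<phi> \<Longrightarrow>
          continuous_map (mat_topology K) euclidean (\<lambda>k. \<phi> (kact k v))"
    and K_differential: "Vector_Spaces.linear smul (*) \<phi> \<Longrightarrow> X \<in> lie_algebra N K \<Longrightarrow>
          ((\<lambda>t. \<phi> (kact (one_param X t) v)) has_vector_derivative \<phi> (act (X, 0\<^sub>m N N) v)) (at 0)"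
    and K_Ad: "k \<in> K \<Longrightarrow> k' \<in> K \<Longrightarrow> k * k' = 1\<^sub>m N \<Longrightarrow> (X, Y) \<in> cx_carrier (lie_algebra N G) \<Longrightarrow>
          kact k (act (X, Y) v) = act (k * X * k', k * Y * k') (kact k v)"

locale irreducible_gK_module = gK_module smul N G K act kact
  for smul :: "complex \<Rightarrow> 'v::ab_group_add \<Rightarrow> 'v" and N G K act kact +
  assumes nontrivial: "\<exists>v::'v. v \<noteq> 0"
    and irreducible: "subspace W \<Longrightarrow>
          (\<And>Z w. Z \<in> cx_carrier (lie_algebra N G) \<Longrightarrow> w \<in> W \<Longrightarrow> act Z w \<in> W) \<Longrightarrow>
          (\<And>k w. k \<in> K \<Longrightarrow> w \<in> W \<Longrightarrow> kact k w \<in> W) \<Longrightarrow> W = {0} \<or> W = UNIV"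


section \<open>K-types\<close>

text \<open>Irreducible continuous modules of a compact group are finite-dimensional, so up to equivalence
  they are matrix representations \<open>(d, \<rho>)\<close> on the column vectors of length \<open>d\<close>.\<close>

abbreviation vec_subspace :: "nat \<Rightarrow> complex vec set \<Rightarrow> bool" where
  "vec_subspace d W \<equiv> VectorSpace.subspace class_ring W (module_vec TYPE(complex) d)"

abbreviation vec_span :: "nat \<Rightarrow> complex vec set \<Rightarrow> complex vec set" where
  "vec_span d S \<equiv> LinearCombinations.module.span class_ring (module_vec TYPE(complex) d) S"

type_synonym mat_rep = "nat \<times> (complex mat \<Rightarrow> complex mat)"

definition continuous_rep :: "complex mat set \<Rightarrow> mat_rep \<Rightarrow> bool" where
  "continuous_rep K r \<longleftrightarrow> (case r of (d, \<rho>) \<Rightarrow>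
     (\<forall>k\<in>K. \<rho> k \<in> GL d) \<and>
     (\<forall>h\<in>K. \<forall>k\<in>K. \<rho> (h * k) = \<rho> h * \<rho> k) \<and>
     (\<forall>i<d. \<forall>j<d. continuous_map (mat_topology K) euclidean (\<lambda>k. \<rho> k $$ (i, j))))"

definition irreps :: "complex mat set \<Rightarrow> mat_rep set" where
  "irreps K = {(d, \<rho>). continuous_rep K (d, \<rho>) \<and> 0 < d \<and>
     (\<forall>W. vec_subspace d W \<and> (\<forall>k\<in>K. \<forall>w\<in>W. \<rho> k *\<^sub>v w \<in> W) \<longrightarrow>
        W = {0\<^sub>v d} \<or> W = carrier_vec d)}"

definition rep_equiv :: "complex mat set \<Rightarrow> mat_rep rel" where
  "rep_equiv K = {((d, \<rho>), (d', \<rho>')). (d, \<rho>) \<in> irreps K \<and> (d', \<rho>') \<in> irreps K \<and> d = d' \<and>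
     (\<exists>T\<in>GL d. \<forall>k\<in>K. T * \<rho> k = \<rho>' k * T)}"

definition ktypes :: "complex mat set \<Rightarrow> mat_rep set set" where
  "ktypes K = irreps K // rep_equiv K"

text \<open>The K-types \<open>\<sigma>\<close> with a nonzero \<open>K\<close>-homomorphism \<open>\<sigma> \<rightarrow> V\<close>. The group \<open>K\<close> acts on \<open>V\<close> through
  its embedding \<open>\<iota>\<close> into the ambient group.\<close>

definition ktypes_in :: "complex mat set \<Rightarrow> (complex mat \<Rightarrow> complex mat) \<Rightarrow>
    (complex \<Rightarrow> 'v::ab_group_add \<Rightarrow> 'v) \<Rightarrow> (complex mat \<Rightarrow> 'v \<Rightarrow> 'v) \<Rightarrow> mat_rep set set" where
  "ktypes_in K \<iota> smul kact = {\<sigma> \<in> ktypes K. \<exists>(d, \<rho>)\<in>\<sigma>. \<exists>T :: complex vec \<Rightarrow> 'v.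
     (\<forall>x\<in>carrier_vec d. \<forall>y\<in>carrier_vec d. T (x + y) = T x + T y) \<and>
     (\<forall>c. \<forall>x\<in>carrier_vec d. T (c \<cdot>\<^sub>v x) = smul c (T x)) \<and>
     (\<forall>k\<in>K. \<forall>x\<in>carrier_vec d. T (\<rho> k *\<^sub>v x) = kact (\<iota> k) (T x)) \<and>
     (\<exists>x\<in>carrier_vec d. T x \<noteq> 0)}"


section \<open>The compact groups U(n), Sp(n), O(n)\<close>

datatype compact_factor = CU nat | CSp nat | CO nat

definition unitary_group :: "nat \<Rightarrow> complex mat set" where
  "unitary_group n = {A \<in> carrier_mat n n. mat_adjoint A * A = 1\<^sub>m n}"

definition Jmat :: "nat \<Rightarrow> complex mat" where
  "Jmat n = four_block_mat (0\<^sub>m n n) (1\<^sub>m n) (- 1\<^sub>m n) (0\<^sub>m n n)"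

fun factor_group :: "compact_factor \<Rightarrow> complex mat set" where
  "factor_group (CU n) = unitary_group n"
| "factor_group (CSp n) = {A \<in> unitary_group (2 * n). transpose_mat A * Jmat n * A = Jmat n}"
| "factor_group (CO n) = {A \<in> unitary_group n. real_mat A}"

text \<open>The product of the factors, as a group of block diagonal matrices.\<close>

definition compact_group :: "compact_factor list \<Rightarrow> complex mat set" where
  "compact_group Ks = diag_block_mat ` listset (map factor_group Ks)"


section \<open>Highest weights\<close>

fun factor_rank :: "compact_factor \<Rightarrow> nat" where
  "factor_rank (CU n) = n"
| "factor_rank (CSp n) = n"
| "factor_rank (CO n) = n"

fun factor_size :: "compact_factor \<Rightarrow> nat" where
  "factor_size (CU n) = n"
| "factor_size (CSp n) = 2 * n"
| "factor_size (CO n) = n"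

text \<open>Tori, root spaces and highest weights are only used for U(n) and Sp(n).\<close>

fun torus :: "compact_factor \<Rightarrow> (nat \<Rightarrow> complex) \<Rightarrow> complex mat" where
  "torus (CU n) t = mat_diag n t"
| "torus (CSp n) t = mat_diag (2 * n) (\<lambda>i. if i < n then t i else cnj (t (i - n)))"

definition char_val :: "nat \<Rightarrow> (nat \<Rightarrow> int) \<Rightarrow> (nat \<Rightarrow> complex) \<Rightarrow> complex" where
  "char_val n \<mu> t = (\<Prod>i<n. t i powi \<mu> i)"

definition unit_coord :: "nat \<Rightarrow> nat \<Rightarrow> int" where
  "unit_coord i = (\<lambda>l. if l = i then 1 else 0)"

fun positive_roots :: "compact_factor \<Rightarrow> (nat \<Rightarrow> int) set" where
  "positive_roots (CU n) = {\<lambda>l. unit_coord i l - unit_coord j l | i j. i < j \<and> j < n}"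
| "positive_roots (CSp n) =
     {\<lambda>l. unit_coord i l - unit_coord j l | i j. i < j \<and> j < n} \<union>
     {\<lambda>l. unit_coord i l + unit_coord j l | i j. i < j \<and> j < n} \<union>
     {\<lambda>l. 2 * unit_coord i l | i. i < n}"

text \<open>For U(n) and Sp(n) the real Lie algebra consists of skew-Hermitian matrices, hence its
  complexification embeds in the complex matrices, with \<open>Z = skew_part Z + \<i> skew_part (- \<i> Z)\<close>.\<close>

definition skew_part :: "complex mat \<Rightarrow> complex mat" where
  "skew_part Z = (1 / 2) \<cdot>\<^sub>m (Z - mat_adjoint Z)"

definition root_space :: "compact_factor \<Rightarrow> (nat \<Rightarrow> int) \<Rightarrow> complex mat set" where
  "root_space c \<alpha> = {Z \<in> carrier_mat (factor_size c) (factor_size c).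
     skew_part Z \<in> lie_algebra (factor_size c) (factor_group c) \<and>
     skew_part (- \<i> \<cdot>\<^sub>m Z) \<in> lie_algebra (factor_size c) (factor_group c) \<and>
     (\<forall>t. (\<forall>i<factor_rank c. cmod (t i) = 1) \<longrightarrow>
        torus c t * Z * torus c (\<lambda>i. cnj (t i)) = char_val (factor_rank c) \<alpha> t \<cdot>\<^sub>m Z)}"

definition differential :: "mat_rep \<Rightarrow> complex mat \<Rightarrow> complex mat" where
  "differential r X = (case r of (d, \<rho>) \<Rightarrow> Matrix.mat d d
     (\<lambda>ij. vector_derivative (\<lambda>t. \<rho> (one_param X t) $$ ij) (at 0)))"

definition cx_differential :: "mat_rep \<Rightarrow> complex mat \<Rightarrow> complex mat" where
  "cx_differential r Z =
     differential r (skew_part Z) + \<i> \<cdot>\<^sub>m differential r (skew_part (- \<i> \<cdot>\<^sub>m Z))"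

definition has_highest_weight :: "compact_factor \<Rightarrow> mat_rep \<Rightarrow> int list \<Rightarrow> bool" where
  "has_highest_weight c r a \<longleftrightarrow> length a = factor_rank c \<and>
     (case r of (d, \<rho>) \<Rightarrow> \<exists>v\<in>carrier_vec d. v \<noteq> 0\<^sub>v d \<and>
        (\<forall>t. (\<forall>i<factor_rank c. cmod (t i) = 1) \<longrightarrow>
           \<rho> (torus c t) *\<^sub>v v = char_val (factor_rank c) (\<lambda>i. a ! i) t \<cdot>\<^sub>v v) \<and>
        (\<forall>\<alpha>\<in>positive_roots c. \<forall>Z\<in>root_space c \<alpha>. cx_differential r Z *\<^sub>v v = 0\<^sub>v d))"


section \<open>The parametrization of O(n)-types\<close>

text \<open>Complete flags with \<open>F (n - i) = (F i)\<^sup>\<bottom>\<close> for the complex bilinear form \<open>x \<bullet> y\<close>. A strict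
  chain of \<open>n + 1\<close> subspaces forces \<open>F i\<close> to have dimension \<open>i\<close>.\<close>

definition self_dual_flag :: "nat \<Rightarrow> (nat \<Rightarrow> complex vec set) \<Rightarrow> bool" where
  "self_dual_flag n F \<longleftrightarrow>
     (\<forall>i\<le>n. vec_subspace n (F i)) \<and> F n = carrier_vec n \<and> (\<forall>i<n. F i \<subset> F (Suc i)) \<and>
     (\<forall>i\<le>n. F (n - i) = {x \<in> carrier_vec n. \<forall>y\<in>F i. x \<bullet> y = 0})"

text \<open>Lie algebra of the Borel subgroup of the complex general linear group stabilizing \<open>F\<close>.\<close>

definition flag_borel :: "nat \<Rightarrow> (nat \<Rightarrow> complex vec set) \<Rightarrow> complex mat set" where
  "flag_borel n F = {Z \<in> carrier_mat n n. \<forall>i\<le>n. \<forall>x\<in>F i. Z *\<^sub>v x \<in> F i}"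

text \<open>Highest weight vectors of a U(n)-module for that Borel subgroup. Borel subgroups are
  connected, so they stabilize the same lines as their Lie algebras.\<close>

definition flag_hw_vectors :: "nat \<Rightarrow> (nat \<Rightarrow> complex vec set) \<Rightarrow> mat_rep \<Rightarrow> complex vec set" where
  "flag_hw_vectors n F r = {v \<in> carrier_vec (fst r). v \<noteq> 0\<^sub>v (fst r) \<and>
     (\<forall>Z\<in>flag_borel n F. \<exists>c. cx_differential r Z *\<^sub>v v = c \<cdot>\<^sub>v v)}"

text \<open>The O(n)-type \<open>(d, \<rho>)\<close> corresponds to the U(n)-type \<open>(e, \<tau>)\<close>: \<open>T\<close> is an isomorphism of
  O(n)-modules from \<open>\<rho>\<close> onto the submodule of \<open>\<tau>\<close> generated by highest weight vectors.\<close>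

definition weyl_corr :: "nat \<Rightarrow> mat_rep \<Rightarrow> mat_rep \<Rightarrow> bool" where
  "weyl_corr n r l \<longleftrightarrow> (case r of (d, \<rho>) \<Rightarrow> case l of (e, \<tau>) \<Rightarrow>
     \<exists>F T. self_dual_flag n F \<and> T \<in> carrier_mat e d \<and>
       inj_on ((*\<^sub>v) T) (carrier_vec d) \<and>
       (*\<^sub>v) T ` carrier_vec d =
         vec_span e {\<tau> k *\<^sub>v v | k v. k \<in> factor_group (CO n) \<and> v \<in> flag_hw_vectors n F (e, \<tau>)} \<and>
       (\<forall>k\<in>factor_group (CO n). T * \<rho> k = \<tau> k * T))"

text \<open>The U(n)-weight attached to \<open>(a\<^sub>1, \<dots>; \<epsilon>)\<close>.\<close>

definition weyl_weight :: "nat \<Rightarrow> int list \<Rightarrow> int \<Rightarrow> int list" where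
  "weyl_weight n a \<epsilon> =
     (let x = length (filter (\<lambda>b. b > 0) a); s = nat ((1 - \<epsilon>) div 2) * (n - 2 * x)
      in take x a @ replicate s 1 @ replicate (n - x - s) 0)"


section \<open>Parameters and parity\<close>

text \<open>\<open>Weight a\<close> parametrizes types of U(n) and Sp(n), \<open>OWeight a \<epsilon>\<close> types of O(n).\<close>

datatype ktype_param = Weight "int list" | OWeight "int list" int

fun factor_has_param :: "compact_factor \<Rightarrow> mat_rep \<Rightarrow> ktype_param \<Rightarrow> bool" where
  "factor_has_param (CU n) r (Weight a) \<longleftrightarrow>
     length a = n \<and> sorted_wrt (\<ge>) a \<and> has_highest_weight (CU n) r a"
| "factor_has_param (CSp n) r (Weight a) \<longleftrightarrow>
     length a = n \<and> sorted_wrt (\<ge>) a \<and> (\<forall>b\<in>set a. b \<ge> 0) \<and> has_highest_weight (CSp n) r a"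
| "factor_has_param (CO n) r (OWeight a \<epsilon>) \<longleftrightarrow>
     length a = n div 2 \<and> sorted_wrt (\<ge>) a \<and> (\<forall>b\<in>set a. b \<ge> 0) \<and> \<epsilon> \<in> {1, -1} \<and>
     (\<exists>l\<in>irreps (factor_group (CU n)).
        has_highest_weight (CU n) l (weyl_weight n a \<epsilon>) \<and> weyl_corr n r l)"
| "factor_has_param _ _ _ \<longleftrightarrow> False"

fun factor_parity :: "compact_factor \<Rightarrow> ktype_param \<Rightarrow> bit" where
  "factor_parity c (Weight a) = of_int (sum_list a)"
| "factor_parity c (OWeight a \<epsilon>) = of_int (sum_list a + (1 - \<epsilon>) div 2 * int (factor_rank c))"

definition kronecker :: "complex mat \<Rightarrow> complex mat \<Rightarrow> complex mat" where
  "kronecker A B = Matrix.mat (dim_row A * dim_row B) (dim_col A * dim_col B)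
     (\<lambda>(i, j). A $$ (i div dim_row B, j div dim_col B) * B $$ (i mod dim_row B, j mod dim_col B))"

definition kronecker_list :: "complex mat list \<Rightarrow> complex mat" where
  "kronecker_list As = foldr kronecker As (1\<^sub>m 1)"

text \<open>\<open>\<sigma>\<close> is the exterior tensor product of types of the factors with the parameters \<open>ps\<close>.
  By the theorem of the highest weight and Weyl's theorem, every K-type has parameters; for O(n)
  they need not be unique.\<close>

definition has_params :: "compact_factor list \<Rightarrow> mat_rep set \<Rightarrow> ktype_param list \<Rightarrow> bool" where
  "has_params Ks \<sigma> ps \<longleftrightarrow> (\<exists>(d, \<rho>)\<in>\<sigma>. \<exists>rs.
     length rs = length Ks \<and> length ps = length Ks \<and>
     (\<forall>i<length Ks. rs ! i \<in> irreps (factor_group (Ks ! i)) \<and>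
        factor_has_param (Ks ! i) (rs ! i) (ps ! i)) \<and>
     (\<forall>ks\<in>listset (map factor_group Ks).
        \<rho> (diag_block_mat ks) = kronecker_list (map2 (\<lambda>r k. snd r k) rs ks)))"

definition parity :: "compact_factor list \<Rightarrow> ktype_param list \<Rightarrow> bit" where
  "parity Ks ps = sum_list (map2 factor_parity Ks ps)"


section \<open>The pairs (G, K)\<close>

datatype classical_pair =
    GL_real nat | GL_complex nat | GL_quaternion nat
  | O_complex nat | O_indefinite nat nat | Sp_indefinite nat nat | U_indefinite nat nat
  | Sp_complex nat | Sp_real nat | O_star nat

definition Imat :: "nat \<Rightarrow> nat \<Rightarrow> complex mat" where
  "Imat p q = diag_block_mat [1\<^sub>m p, - 1\<^sub>m q]"

definition Jmat2 :: "nat \<Rightarrow> nat \<Rightarrow> complex mat" where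
  "Jmat2 p q = diag_block_mat [Jmat p, Jmat q]"

fun pair_size :: "classical_pair \<Rightarrow> nat" where
  "pair_size (GL_real m) = m"
| "pair_size (GL_complex m) = m"
| "pair_size (GL_quaternion m) = 2 * m"
| "pair_size (O_complex p) = p"
| "pair_size (O_indefinite p q) = p + q"
| "pair_size (Sp_indefinite p q) = 2 * p + 2 * q"
| "pair_size (U_indefinite p q) = p + q"
| "pair_size (Sp_complex n) = 2 * n"
| "pair_size (Sp_real n) = 2 * n"
| "pair_size (O_star n) = 2 * n"

text \<open>Quaternionic matrices are complex matrices \<open>A\<close> with \<open>A J = J cnj(A)\<close>. For Sp(p,q) the
  coordinates of the first \<open>p\<close> and of the last \<open>q\<close> quaternions are grouped together, so that
  \<open>Sp(p) \<times> Sp(q)\<close> is block diagonal.\<close>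

fun pair_group :: "classical_pair \<Rightarrow> complex mat set" where
  "pair_group (GL_real m) = {A \<in> GL m. real_mat A}"
| "pair_group (GL_complex m) = GL m"
| "pair_group (GL_quaternion m) = {A \<in> GL (2 * m). A * Jmat m = Jmat m * cnj_mat A}"
| "pair_group (O_complex p) = {A \<in> carrier_mat p p. transpose_mat A * A = 1\<^sub>m p}"
| "pair_group (O_indefinite p q) = {A \<in> carrier_mat (p + q) (p + q).
     real_mat A \<and> transpose_mat A * Imat p q * A = Imat p q}"
| "pair_group (Sp_indefinite p q) = {A \<in> carrier_mat (2 * p + 2 * q) (2 * p + 2 * q).
     A * Jmat2 p q = Jmat2 p q * cnj_mat A \<and>
     mat_adjoint A * Imat (2 * p) (2 * q) * A = Imat (2 * p) (2 * q)}"
| "pair_group (U_indefinite p q) = {A \<in> carrier_mat (p + q) (p + q).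
     mat_adjoint A * Imat p q * A = Imat p q}"
| "pair_group (Sp_complex n) = {A \<in> carrier_mat (2 * n) (2 * n).
     transpose_mat A * Jmat n * A = Jmat n}"
| "pair_group (Sp_real n) = {A \<in> carrier_mat (2 * n) (2 * n).
     real_mat A \<and> transpose_mat A * Jmat n * A = Jmat n}"
| "pair_group (O_star n) = {A \<in> carrier_mat (2 * n) (2 * n).
     transpose_mat A * A = 1\<^sub>m (2 * n) \<and> mat_adjoint A * Jmat n * A = Jmat n}"

fun pair_factors :: "classical_pair \<Rightarrow> compact_factor list" where
  "pair_factors (GL_real m) = [CO m]"
| "pair_factors (GL_complex m) = [CU m]"
| "pair_factors (GL_quaternion m) = [CSp m]"
| "pair_factors (O_complex p) = [CO p]"
| "pair_factors (O_indefinite p q) = [CO p, CO q]"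
| "pair_factors (Sp_indefinite p q) = [CSp p, CSp q]"
| "pair_factors (U_indefinite p q) = [CU p, CU q]"
| "pair_factors (Sp_complex n) = [CSp n]"
| "pair_factors (Sp_real n) = [CU n]"
| "pair_factors (O_star n) = [CU n]"

abbreviation pair_K :: "classical_pair \<Rightarrow> complex mat set" where
  "pair_K P \<equiv> compact_group (pair_factors P)"

text \<open>\<open>A + \<i> B \<mapsto> (A, B; - B, A)\<close> for real \<open>A\<close> and \<open>B\<close>.\<close>

definition realify :: "complex mat \<Rightarrow> complex mat" where
  "realify A = four_block_mat
     (map_mat (\<lambda>z. complex_of_real (Re z)) A) (map_mat (\<lambda>z. complex_of_real (Im z)) A)
     (map_mat (\<lambda>z. complex_of_real (- Im z)) A) (map_mat (\<lambda>z. complex_of_real (Re z)) A)"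

fun pair_embed :: "classical_pair \<Rightarrow> complex mat \<Rightarrow> complex mat" where
  "pair_embed (Sp_real n) A = realify A"
| "pair_embed (O_star n) A = realify A"
| "pair_embed _ A = A"

end

theory Submission
  imports Defs
begin

text \<open>The matrix \<open>-1\<close> lies in \<open>K\<close>, commutes with \<open>K\<close> and acts trivially on the Lie algebra of \<open>G\<close>,
  so its eigenspaces in a \<open>(\<gg>, K)\<close>-module are submodules, and on an irreducible module it acts by a
  scalar. On a \<open>K\<close>-type \<open>\<sigma>\<close> it acts by the sign \<open>(-1)\<^sup>\<epsilon>\<close> with \<open>\<epsilon>\<close> the parity of \<open>\<sigma>\<close>: for \<open>U(n)\<close>
  and \<open>Sp(n)\<close> the scalar is read off at a highest weight vector, since \<open>-1\<close> lies in the torus, and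
  for \<open>O(n)\<close> it is inherited from the \<open>U(n)\<close>-type containing \<open>\<sigma>\<close>.\<close>

text \<open>The faithful character of Z/2: it turns parities into the scalars by which -1 acts, and
  its injectivity recovers the parity from the scalar.\<close>

definition parity_sign :: "bit \<Rightarrow> complex" where
  "parity_sign b = (if b = 0 then 1 else - 1)"

lemma parity_sign_add: "parity_sign (a + b) = parity_sign a * parity_sign b"
  by (cases "a = 0"; cases "b = 0") (simp_all add: parity_sign_def)

lemma parity_sign_eq_iff: "parity_sign a = parity_sign b \<longleftrightarrow> a = b"
  by (cases "a = 0"; cases "b = 0") (simp_all add: parity_sign_def)

lemma parity_sign_of_int: "parity_sign (of_int m) = (- 1) powi m"
proof (cases "even m")
  case True
  then obtain k where "m = 2 * k"
    by (elim evenE)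
  then show ?thesis
    by (simp add: parity_sign_def)
next
  case False
  then obtain k where "m = 2 * k + 1"
    by (elim oddE)
  then show ?thesis
    by (simp add: parity_sign_def)
qed

text \<open>The weights may have negative entries, so adding exponents requires
  \<open>z \<noteq> 0\<close>.\<close>

lemma prod_powi_nth:
  fixes z :: complex
  assumes "z \<noteq> 0"
  shows "(\<Prod>i<length a. z powi (a ! i)) = z powi (sum_list a)"
proof (induction a)
  case (Cons x a)
  then show ?case
    using assms by (simp add: prod.lessThan_Suc_shift power_int_add del: prod.lessThan_Suc)
qed simp

lemma char_val_minus_one:
  "char_val (length a) (\<lambda>i. a ! i) (\<lambda>_. - 1) = parity_sign (of_int (sum_list a))"
  by (simp add: char_val_def prod_powi_nth parity_sign_of_int)


section \<open>Scalar action of \<open>-1\<close> on an irreducible matrix representation\<close>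

lemma eigenspace_vec_subspace:
  assumes "A \<in> carrier_mat d d"
  shows "vec_subspace d {w \<in> carrier_vec d. A *\<^sub>v w = c \<cdot>\<^sub>v w}"
  unfolding subspace_def submodule_def
  using assms
  by (auto simp: vec_vs vec_module module_vec_simps class_ring_simps mult_add_distrib_mat_vec
      smult_add_distrib_vec mult_mat_vec smult_smult_assoc mult.commute)

lemma mat_eq_smult_one:
  fixes A :: "complex mat"
  assumes A: "A \<in> carrier_mat d d" and "\<And>w. w \<in> carrier_vec d \<Longrightarrow> A *\<^sub>v w = c \<cdot>\<^sub>v w"
  shows "A = c \<cdot>\<^sub>m 1\<^sub>m d"
proof (rule eq_matI)
  fix i j assume ij: "i < dim_row (c \<cdot>\<^sub>m 1\<^sub>m d)" "j < dim_col (c \<cdot>\<^sub>m 1\<^sub>m d)"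
  have "A $$ (i, j) = (A *\<^sub>v unit_vec d j) $ i"
    using A ij by simp
  also have "\<dots> = (c \<cdot>\<^sub>v unit_vec d j) $ i"
    using assms(2)[of "unit_vec d j"] by simp
  finally show "A $$ (i, j) = (c \<cdot>\<^sub>m 1\<^sub>m d) $$ (i, j)"
    using ij by (auto simp: unit_vec_def)
qed (use A in auto)

lemma continuous_rep_carrier:
  assumes "continuous_rep K (d, \<rho>)" "k \<in> K"
  shows "\<rho> k \<in> carrier_mat d d"
  using assms by (auto simp: continuous_rep_def GL_def)

text \<open>Schur's lemma with a known eigenvalue: \<open>z\<close> commutes with \<open>K\<close>,
  so its eigenspace for \<open>c\<close> is invariant, and it contains the nonzero vector
  \<open>v\<close>.\<close>

lemma irrep_central_scalar:
  assumes r: "(d, \<rho>) \<in> irreps K"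
    and z: "z \<in> K" and central: "\<And>k. k \<in> K \<Longrightarrow> k * z = z * k"
    and v: "v \<in> carrier_vec d" "v \<noteq> 0\<^sub>v d" "\<rho> z *\<^sub>v v = c \<cdot>\<^sub>v v"
  shows "\<rho> z = c \<cdot>\<^sub>m 1\<^sub>m d"
proof -
  define W where "W = {w \<in> carrier_vec d. \<rho> z *\<^sub>v w = c \<cdot>\<^sub>v w}"
  have rep: "continuous_rep K (d, \<rho>)"
    using r by (simp add: irreps_def)
  note carrier = continuous_rep_carrier[OF rep]
  have mult: "\<rho> (h * k) = \<rho> h * \<rho> k" if "h \<in> K" "k \<in> K" for h k
    using rep that by (simp add: continuous_rep_def)
  have "\<rho> k *\<^sub>v w \<in> W" if k: "k \<in> K" and w: "w \<in> W" for k w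
  proof -
    have wd: "w \<in> carrier_vec d"
      using w by (simp add: W_def)
    have "\<rho> z *\<^sub>v (\<rho> k *\<^sub>v w) = \<rho> (z * k) *\<^sub>v w"
      using carrier k z wd by (simp add: mult assoc_mult_mat_vec[of _ d d _ d])
    also have "\<dots> = \<rho> k *\<^sub>v (\<rho> z *\<^sub>v w)"
      using carrier k z wd
      by (simp add: central[OF k, symmetric] mult assoc_mult_mat_vec[of _ d d _ d])
    also have "\<dots> = c \<cdot>\<^sub>v (\<rho> k *\<^sub>v w)"
      using w carrier[OF k] by (simp add: W_def mult_mat_vec)
    finally show ?thesis
      using carrier[OF k] wd by (simp add: W_def)
  qed
  moreover have "vec_subspace d W"
    unfolding W_def by (rule eigenspace_vec_subspace[OF carrier[OF z]])
  ultimately have "W = {0\<^sub>v d} \<or> W = carrier_vec d"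
    using r unfolding irreps_def by blast
  moreover have "v \<in> W"
    using v by (simp add: W_def)
  ultimately have "W = carrier_vec d"
    using v(2) by blast
  then show ?thesis
    using mat_eq_smult_one[OF carrier[OF z]] unfolding W_def by blast
qed

section \<open>Transport of scalar action along intertwining maps\<close>

lemma smult_mat_mult_vec:
  fixes A :: "'a :: comm_semiring_0 mat"
  assumes "dim_vec w = dim_col A"
  shows "(c \<cdot>\<^sub>m A) *\<^sub>v w = c \<cdot>\<^sub>v (A *\<^sub>v w)"
  using assms by (intro eq_vecI) (auto simp: scalar_prod_def sum_distrib_left ac_simps)

text \<open>Applied to intertwining maps: a scalar action on the target passes to the source of an
  injective map. \<open>T\<close> need not be square, since for O(n) it embeds the type in a larger
  U(n)-module.\<close>

lemma mult_injective_mat_cancel: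
  fixes T :: "complex mat"
  assumes T: "T \<in> carrier_mat e d" and inj: "inj_on ((*\<^sub>v) T) (carrier_vec d)"
    and A: "A \<in> carrier_mat d d" and eq: "T * A = c \<cdot>\<^sub>m T"
  shows "A = c \<cdot>\<^sub>m 1\<^sub>m d"
proof (rule mat_eq_smult_one[OF A])
  fix w :: "complex vec" assume w: "w \<in> carrier_vec d"
  have "T *\<^sub>v (A *\<^sub>v w) = (T * A) *\<^sub>v w"
    using T A w by simp
  also have "\<dots> = T *\<^sub>v (c \<cdot>\<^sub>v w)"
    using T w unfolding eq by (simp add: smult_mat_mult_vec mult_mat_vec)
  finally show "A *\<^sub>v w = c \<cdot>\<^sub>v w"
    using inj A w by (auto dest!: inj_onD)
qed

lemma GL_inverse:
  assumes "T \<in> GL d"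
  obtains S where "S \<in> carrier_mat d d" "S * T = 1\<^sub>m d" "T * S = 1\<^sub>m d"
proof -
  from assms obtain S where T: "T \<in> carrier_mat d d"
    and S: "S * T = 1\<^sub>m (dim_row S)" "T * S = 1\<^sub>m (dim_row T)"
    by (auto simp: GL_def invertible_mat_def inverts_mat_def)
  \<comment> \<open>The format of \<open>S\<close> is read off from the identity matrices that the
    two products equal.\<close>
  have "dim_row S = d" "dim_col S = d"
    using arg_cong[OF S(1), of dim_col] arg_cong[OF S(2), of dim_col] T by auto
  then show thesis
    using S T by (intro that[of S]) auto
qed

lemma inj_on_GL:
  assumes "T \<in> GL d"
  shows "inj_on ((*\<^sub>v) T) (carrier_vec d)"
proof -
  obtain S where "S \<in> carrier_mat d d" "S * T = 1\<^sub>m d"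
    using GL_inverse[OF assms] by blast
  moreover have "T \<in> carrier_mat d d"
    using assms by (simp add: GL_def)
  ultimately have "S *\<^sub>v (T *\<^sub>v x) = x" if "x \<in> carrier_vec d" for x
    using that by (simp flip: assoc_mult_mat_vec)
  then show ?thesis
    by (metis inj_on_inverseI)
qed

text \<open>Scalar matrices are fixed by conjugation. Both directions serve to pass from one member
  of a class to its chosen representative and on to another member.\<close>

lemma rep_equiv_scalar_iff:
  assumes "((d, \<rho>), (d', \<rho>')) \<in> rep_equiv K" "z \<in> K"
  shows "\<rho> z = c \<cdot>\<^sub>m 1\<^sub>m d \<longleftrightarrow> \<rho>' z = c \<cdot>\<^sub>m 1\<^sub>m d'"
proof -
  from assms obtain T where d: "d' = d" and T: "T \<in> GL d" and comm: "T * \<rho> z = \<rho>' z * T"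
    and r: "(d, \<rho>) \<in> irreps K" "(d, \<rho>') \<in> irreps K"
    by (auto simp: rep_equiv_def)
  have Tc: "T \<in> carrier_mat d d"
    using T by (simp add: GL_def)
  obtain S where Sc: "S \<in> carrier_mat d d" and S: "T * S = 1\<^sub>m d"
    using GL_inverse[OF T] by blast
  have c: "\<rho> z \<in> carrier_mat d d" "\<rho>' z \<in> carrier_mat d d"
    using r assms(2) by (auto simp: irreps_def intro: continuous_rep_carrier)
  show ?thesis
  proof
    assume "\<rho> z = c \<cdot>\<^sub>m 1\<^sub>m d"
    then have "\<rho>' z * T = c \<cdot>\<^sub>m T"
      using comm Tc by (simp add: mult_smult_distrib[of _ d d _ d])
    then have "\<rho>' z * (T * S) = c \<cdot>\<^sub>m (T * S)"
      using c Tc Sc by (simp flip: assoc_mult_mat[of _ d d _ d _ d] add: mult_smult_assoc_mat[of _ d d _ d])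
    then show "\<rho>' z = c \<cdot>\<^sub>m 1\<^sub>m d'"
      using c by (simp add: S d)
  next
    assume "\<rho>' z = c \<cdot>\<^sub>m 1\<^sub>m d'"
    then have "T * \<rho> z = c \<cdot>\<^sub>m T"
      using comm Tc by (simp add: d mult_smult_assoc_mat[of _ d d _ d])
    then show "\<rho> z = c \<cdot>\<^sub>m 1\<^sub>m d"
      by (rule mult_injective_mat_cancel[OF Tc inj_on_GL[OF T] c(1)])
  qed
qed

lemma ktype_scalar:
  assumes "\<sigma> \<in> ktypes K" "(d, \<rho>) \<in> \<sigma>" "(d', \<rho>') \<in> \<sigma>" "z \<in> K" "\<rho> z = c \<cdot>\<^sub>m 1\<^sub>m d"
  shows "\<rho>' z = c \<cdot>\<^sub>m 1\<^sub>m d'"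
proof -
  \<comment> \<open>\<open>(d0, \<rho>0)\<close> is the representative whose image under
    \<open>rep_equiv K\<close> is the class \<open>\<sigma>\<close>.\<close>
  obtain d0 \<rho>0 where "((d0, \<rho>0), (d, \<rho>)) \<in> rep_equiv K" "((d0, \<rho>0), (d', \<rho>')) \<in> rep_equiv K"
    using assms(1-3) by (auto simp: ktypes_def quotient_def)
  then show ?thesis
    using assms(4,5) by (auto dest: rep_equiv_scalar_iff)
qed


section \<open>The matrix \<open>-1\<close> in the compact groups\<close>

abbreviation neg_one :: "nat \<Rightarrow> complex mat" where
  "neg_one n \<equiv> - 1\<^sub>m n"

lemma neg_one_central:
  "A \<in> carrier_mat n n \<Longrightarrow> A * neg_one n = neg_one n * A"
  by simp

lemma mat_adjoint_neg_one: "mat_adjoint (neg_one n) = neg_one n"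
  by (rule eq_matI) (auto simp: mat_adjoint_def mat_of_rows_def)

lemma neg_one_unitary: "neg_one n \<in> unitary_group n"
  by (simp add: unitary_group_def mat_adjoint_neg_one)

lemma dim_Jmat [simp]: "dim_row (Jmat n) = 2 * n" "dim_col (Jmat n) = 2 * n"
  by (simp_all add: Jmat_def)

text \<open>The matrix -1 is real, symmetric and unitary, and the two signs cancel in the form
  defined by \<open>Jmat n\<close>.\<close>

lemma neg_one_factor_group: "neg_one (factor_size c) \<in> factor_group c"
proof (cases c)
  case (CSp n)
  have "transpose_mat (neg_one (2 * n)) = neg_one (2 * n)"
    by (rule eq_matI) auto
  then show ?thesis
    using CSp neg_one_unitary left_mult_one_mat'[of "Jmat n" "2 * n"]
      right_mult_one_mat'[of "Jmat n" "2 * n"] by simp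
next
  case (CO n)
  have "real_mat (neg_one n)"
    by (auto simp: real_mat_def elements_mat_def)
  then show ?thesis
    using CO neg_one_unitary by simp
qed (simp add: neg_one_unitary)

lemma factor_group_carrier:
  "A \<in> factor_group c \<Longrightarrow> A \<in> carrier_mat (factor_size c) (factor_size c)"
  by (cases c) (auto simp: unitary_group_def)

text \<open>For Sp(n) the second half of the diagonal holds conjugates, and -1 is its own
  conjugate.\<close>

lemma torus_minus_one: "c \<in> {CU n, CSp n} \<Longrightarrow> torus c (\<lambda>_. - 1) = neg_one (factor_size c)"
  by (auto simp: mat_diag_def)

text \<open>At the torus point with all coordinates -1 the weight \<open>a\<close> takes the value
  (-1) to the power \<open>sum_list a\<close>; centrality spreads this scalar from the highest
  weight vector to the whole module.\<close>

lemma highest_weight_scalar: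
  assumes c: "c \<in> {CU n, CSp n}" and r: "r \<in> irreps (factor_group c)"
    and hw: "has_highest_weight c r a"
  shows "snd r (neg_one (factor_size c)) = parity_sign (of_int (sum_list a)) \<cdot>\<^sub>m 1\<^sub>m (fst r)"
proof -
  obtain d \<rho> where rd: "r = (d, \<rho>)"
    by force
  from hw obtain v where la: "length a = factor_rank c" and v: "v \<in> carrier_vec d" "v \<noteq> 0\<^sub>v d"
    and ev: "\<And>t. (\<forall>i<factor_rank c. cmod (t i) = 1) \<Longrightarrow>
           \<rho> (torus c t) *\<^sub>v v = char_val (factor_rank c) (\<lambda>i. a ! i) t \<cdot>\<^sub>v v"
    unfolding has_highest_weight_def rd by auto
  have "\<rho> (neg_one (factor_size c)) *\<^sub>v v = parity_sign (of_int (sum_list a)) \<cdot>\<^sub>v v"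
    using ev[of "\<lambda>_. - 1"] by (simp add: torus_minus_one[OF c] char_val_minus_one flip: la)
  then show ?thesis
    using irrep_central_scalar[OF r[unfolded rd] neg_one_factor_group _ v]
      neg_one_central factor_group_carrier by (simp add: rd)
qed

section \<open>Parity under Weyl's correspondence\<close>

lemma sum_list_filter_pos:
  fixes a :: "int list"
  assumes "sorted_wrt (\<ge>) a" "\<forall>b\<in>set a. b \<ge> 0"
  shows "sum_list (take (length (filter (\<lambda>b. b > 0) a)) a) = sum_list a"
  using assms
proof (induction a)
  case (Cons x a)
  show ?case
  proof (cases "x > 0")
    case False
    \<comment> \<open>The list is nonincreasing and nonnegative, so after a head that is not
      positive everything vanishes; the positive entries form an initial segment.\<close>
    then have "\<forall>b\<in>set (x # a). b = 0"
      using Cons.prems by force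
    then have "sum_list (x # a) = 0" "filter (\<lambda>b. b > 0) (x # a) = []"
      by (auto simp: filter_empty_conv intro!: sum_list_neutral)
    then show ?thesis
      by simp
  qed (use Cons in auto)
qed simp

text \<open>The inserted ones number (1 - \<epsilon>)/2 times n - 2x, which is congruent to (1 -
  \<epsilon>)/2 times n modulo 2.\<close>

lemma weyl_weight_parity:
  assumes a: "length a = n div 2" "sorted_wrt (\<ge>) a" "\<forall>b\<in>set a. b \<ge> 0" and e: "\<epsilon> \<in> {1, -1}"
  shows "(of_int (sum_list (weyl_weight n a \<epsilon>)) :: bit) =
    of_int (sum_list a + (1 - \<epsilon>) div 2 * int n)"
proof -
  define x where "x = length (filter (\<lambda>b. b > 0) a)"
  \<comment> \<open>This bound makes the subtraction of naturals in \<open>weyl_weight\<close> agree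
    with that of integers.\<close>
  have "2 * x \<le> n"
    using length_filter_le[of "\<lambda>b. b > 0" a] a(1) by (simp add: x_def)
  then have n: "int (n - 2 * x) = int n - 2 * int x"
    by simp
  \<comment> \<open>For \<epsilon> = 1 or -1 the factor \<open>(1 - \<epsilon>) div 2\<close> is 0
    or 1, so \<open>nat\<close> does not change its value.\<close>
  have "sum_list (weyl_weight n a \<epsilon>) = sum_list a + (1 - \<epsilon>) div 2 * int (n - 2 * x)"
    using e sum_list_filter_pos[OF a(2,3)]
    by (auto simp: weyl_weight_def Let_def sum_list_replicate simp flip: x_def)
  also have "\<dots> = sum_list a + (1 - \<epsilon>) div 2 * int n - 2 * ((1 - \<epsilon>) div 2 * int x)"
    unfolding n by (simp add: right_diff_distrib mult.left_commute)
  finally have "sum_list (weyl_weight n a \<epsilon>) =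
    sum_list a + (1 - \<epsilon>) div 2 * int n - 2 * ((1 - \<epsilon>) div 2 * int x)" .
  then show ?thesis
    by (simp add: of_int_diff)
qed

lemma factor_param_scalar:
  assumes r: "r \<in> irreps (factor_group c)" and p: "factor_has_param c r p"
  shows "snd r (neg_one (factor_size c)) = parity_sign (factor_parity c p) \<cdot>\<^sub>m 1\<^sub>m (fst r)"
proof (cases "(c, r, p)" rule: factor_has_param.cases)
  case (1 n r' a)
  then show ?thesis
    using p highest_weight_scalar[OF _ r, of n a] by simp
next
  case (2 n r' a)
  then show ?thesis
    using p highest_weight_scalar[OF _ r, of n a] by simp
next
  case (3 n r' a \<epsilon>)
  obtain d \<rho> where rd: "r = (d, \<rho>)"
    by force
  from p 3 obtain e \<tau> where a: "length a = n div 2" "sorted_wrt (\<ge>) a" "\<forall>b\<in>set a. b \<ge> 0"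
    and \<epsilon>: "\<epsilon> \<in> {1, -1}"
    and l: "(e, \<tau>) \<in> irreps (factor_group (CU n))"
    and hw: "has_highest_weight (CU n) (e, \<tau>) (weyl_weight n a \<epsilon>)"
    and weyl: "weyl_corr n (d, \<rho>) (e, \<tau>)"
    by (auto simp: rd)
  have neg: "neg_one n \<in> factor_group (CO n)"
    using neg_one_factor_group[of "CO n"] by simp
  \<comment> \<open>\<open>T\<close> embeds the O(n)-type in the restriction of the U(n)-type, where
    the scalar of -1 is known.\<close>
  from weyl neg obtain T where T: "T \<in> carrier_mat e d" "inj_on ((*\<^sub>v) T) (carrier_vec d)"
    and comm: "T * \<rho> (neg_one n) = \<tau> (neg_one n) * T"
    unfolding weyl_corr_def by blast
  have "\<tau> (neg_one n) = parity_sign (of_int (sum_list (weyl_weight n a \<epsilon>))) \<cdot>\<^sub>m 1\<^sub>m e"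
    using highest_weight_scalar[of "CU n" n, OF _ l hw] by simp
  then have "T * \<rho> (neg_one n) = parity_sign (factor_parity c p) \<cdot>\<^sub>m T"
    using comm T(1) weyl_weight_parity[OF a \<epsilon>] 3
    by (simp add: mult_smult_assoc_mat[of _ e e _ d])
  moreover have "\<rho> (neg_one n) \<in> carrier_mat d d"
    using r 3 neg by (auto simp: rd irreps_def intro: continuous_rep_carrier)
  ultimately have "\<rho> (neg_one n) = parity_sign (factor_parity c p) \<cdot>\<^sub>m 1\<^sub>m d"
    using mult_injective_mat_cancel[OF T] by blast
  moreover have "factor_size c = n"
    using 3 by simp
  ultimately show ?thesis
    by (simp add: rd)
qed (use p in auto)


section \<open>Products of compact groups\<close>

lemma kronecker_smult_one:
  "kronecker (a \<cdot>\<^sub>m 1\<^sub>m p) (b \<cdot>\<^sub>m 1\<^sub>m q) = (a * b) \<cdot>\<^sub>m 1\<^sub>m (p * q)"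
proof (rule eq_matI)
  fix i j assume ij: "i < dim_row ((a * b) \<cdot>\<^sub>m 1\<^sub>m (p * q))" "j < dim_col ((a * b) \<cdot>\<^sub>m 1\<^sub>m (p * q))"
  \<comment> \<open>Otherwise the matrix has no entries; division with remainder by \<open>q\<close>
    then splits an index into its two factors.\<close>
  then have "q > 0"
    by (cases q) auto
  then have "i div q < p" "j div q < p" "i mod q < q" "j mod q < q"
    using ij by (auto simp: less_mult_imp_div_less)
  moreover have "i = j \<longleftrightarrow> i div q = j div q \<and> i mod q = j mod q"
    by (metis div_mult_mod_eq)
  ultimately show "kronecker (a \<cdot>\<^sub>m 1\<^sub>m p) (b \<cdot>\<^sub>m 1\<^sub>m q) $$ (i, j) = ((a * b) \<cdot>\<^sub>m 1\<^sub>m (p * q)) $$ (i, j)"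
    using ij by (auto simp: kronecker_def)
qed (simp_all add: kronecker_def)

text \<open>Signs multiply under tensor products while parities add. The size \<open>e\<close> is
  left open here and is found later by comparing formats.\<close>

lemma kronecker_list_scalar:
  assumes "length Ks = length rs" "length rs = length ps"
    and "\<forall>i<length Ks. rs ! i \<in> irreps (factor_group (Ks ! i)) \<and>
        factor_has_param (Ks ! i) (rs ! i) (ps ! i)"
  shows "\<exists>e. kronecker_list (map2 (\<lambda>r k. snd r k) rs (map (\<lambda>c. neg_one (factor_size c)) Ks)) =
    parity_sign (parity Ks ps) \<cdot>\<^sub>m 1\<^sub>m e"
  using assms
proof (induction Ks rs ps rule: list_induct3)
  case Nil
  then show ?case
    \<comment> \<open>The empty product is the 1 by 1 identity matrix, matching the empty parity sum
      0.\<close>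
    by (auto simp: kronecker_list_def parity_def parity_sign_def intro!: exI[of _ 1])
next
  case (Cons c Ks r rs p ps)
  then obtain e where "kronecker_list (map2 (\<lambda>r k. snd r k) rs (map (\<lambda>c. neg_one (factor_size c)) Ks)) =
    parity_sign (parity Ks ps) \<cdot>\<^sub>m 1\<^sub>m e"
    by (auto simp: All_less_Suc2)
  moreover have "snd r (neg_one (factor_size c)) = parity_sign (factor_parity c p) \<cdot>\<^sub>m 1\<^sub>m (fst r)"
    using Cons.prems by (intro factor_param_scalar) (auto simp: All_less_Suc2)
  \<comment> \<open>Addition of bits must not be rewritten as exclusive or, so that
    \<open>parity_sign_add\<close> applies.\<close>
  ultimately show ?case
    by (auto simp: kronecker_list_def parity_def parity_sign_add kronecker_smult_one
        simp del: add_bit_eq_xor)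
qed

lemma neg_ones_listset:
  "map (\<lambda>c. neg_one (factor_size c)) Ks \<in> listset (map factor_group Ks)"
  by (induction Ks) (auto simp: set_Cons_def neg_one_factor_group)

lemma diag_block_neg_ones:
  "diag_block_mat (map (\<lambda>c. neg_one (factor_size c)) Ks) = neg_one (sum_list (map factor_size Ks))"
  by (induction Ks) (auto simp: Let_def intro!: eq_matI)

lemma neg_one_compact_group: "neg_one (sum_list (map factor_size Ks)) \<in> compact_group Ks"
  unfolding compact_group_def diag_block_neg_ones[symmetric] by (rule imageI[OF neg_ones_listset])

text \<open>The parameters describe only one member of the class, a tensor product;
  \<open>ktype_scalar\<close> carries its scalar to every other member.\<close>

lemma has_params_scalar:
  assumes \<sigma>: "\<sigma> \<in> ktypes (compact_group Ks)" and "has_params Ks \<sigma> ps" and "(d', \<rho>') \<in> \<sigma>"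
  shows "\<rho>' (neg_one (sum_list (map factor_size Ks))) = parity_sign (parity Ks ps) \<cdot>\<^sub>m 1\<^sub>m d'"
proof -
  from assms(2) obtain d \<rho> rs where r: "(d, \<rho>) \<in> \<sigma>"
    and len: "length rs = length Ks" "length ps = length Ks"
    and params: "\<forall>i<length Ks. rs ! i \<in> irreps (factor_group (Ks ! i)) \<and>
        factor_has_param (Ks ! i) (rs ! i) (ps ! i)"
    and kron: "\<forall>ks\<in>listset (map factor_group Ks).
        \<rho> (diag_block_mat ks) = kronecker_list (map2 (\<lambda>r k. snd r k) rs ks)"
    unfolding has_params_def by auto
  obtain e where e: "\<rho> (neg_one (sum_list (map factor_size Ks))) = parity_sign (parity Ks ps) \<cdot>\<^sub>m 1\<^sub>m e"
    using kronecker_list_scalar[OF _ _ params] len bspec[OF kron neg_ones_listset]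
    by (auto simp: diag_block_neg_ones)
  have "(d, \<rho>) \<in> irreps (compact_group Ks)"
    using \<sigma> r by (auto simp: ktypes_def quotient_def rep_equiv_def)
  then have "\<rho> (neg_one (sum_list (map factor_size Ks))) \<in> carrier_mat d d"
    using neg_one_compact_group by (auto simp: irreps_def intro: continuous_rep_carrier)
  \<comment> \<open>The same matrix has format \<open>e\<close> as a scalar matrix and format
    \<open>d\<close> as a value of \<open>\<rho>\<close>.\<close>
  then have "e = d"
    using e by auto
  then show ?thesis
    using ktype_scalar[OF \<sigma> r assms(3) neg_one_compact_group] e by simp
qed

lemma listset_factor_group_dims:
  "ks \<in> listset (map factor_group Ks) \<Longrightarrow>
     map dim_row ks = map factor_size Ks \<and> map dim_col ks = map factor_size Ks"
  by (induction Ks arbitrary: ks) (auto simp: set_Cons_def dest: factor_group_carrier)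

lemma compact_group_carrier:
  "k \<in> compact_group Ks \<Longrightarrow>
     k \<in> carrier_mat (sum_list (map factor_size Ks)) (sum_list (map factor_size Ks))"
  by (auto simp: compact_group_def dim_diag_block_mat dest!: listset_factor_group_dims)


section \<open>Scalar action of \<open>-1\<close> on an irreducible module\<close>

lemma pair_embed_carrier:
  "k \<in> pair_K P \<Longrightarrow> pair_embed P k \<in> carrier_mat (pair_size P) (pair_size P)"
  by (cases P) (auto dest!: compact_group_carrier simp: realify_def)

lemma realify_neg_one: "realify (neg_one n) = neg_one (2 * n)"
  by (rule eq_matI) (auto simp: realify_def)

lemma pair_embed_neg_one:
  "pair_embed P (neg_one (sum_list (map factor_size (pair_factors P)))) = neg_one (pair_size P)"
  by (cases P) (simp_all add: realify_neg_one)

lemma neg_one_pair_K: "neg_one (pair_size P) \<in> pair_embed P ` pair_K P"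
  unfolding pair_embed_neg_one[symmetric] by (rule imageI[OF neg_one_compact_group])

text \<open>The eigenspace argument again, now with stability under the Lie algebra as well, because
  conjugation by -1 is trivial on matrices.\<close>

lemma (in irreducible_gK_module) neg_one_scalar:
  assumes K: "K \<subseteq> carrier_mat N N" and z: "neg_one N \<in> K"
    and v: "v \<noteq> 0" "kact (neg_one N) v = smul c v"
  shows "kact (neg_one N) w = smul c w"
proof -
  define W where "W = {w. kact (neg_one N) w = smul c w}"
  interpret z: Vector_Spaces.linear smul smul "kact (neg_one N)"
    by (rule kact_linear[OF z])
  have "subspace W"
    unfolding subspace_def W_def
    by (auto simp: z.add z.scale scale_right_distrib scale_left_commute)
  moreover have "act Z w \<in> W" if Z: "Z \<in> cx_carrier (lie_algebra N G)" and w: "w \<in> W" for Z w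
  proof -
    obtain X Y where XY: "Z = (X, Y)" and c: "X \<in> carrier_mat N N" "Y \<in> carrier_mat N N"
      using Z by (cases Z) (auto simp: cx_carrier_def lie_algebra_def)
    interpret Z: Vector_Spaces.linear smul smul "act Z"
      by (rule act_linear[OF Z])
    \<comment> \<open>Since -1 is its own inverse, it serves as both \<open>k\<close> and
      \<open>k'\<close> in \<open>K_Ad\<close>.\<close>
    have "neg_one N * X * neg_one N = X" "neg_one N * Y * neg_one N = Y"
      using c by auto
    then have "kact (neg_one N) (act Z w) = act Z (kact (neg_one N) w)"
      using K_Ad[OF z z, of X Y w] Z by (simp add: XY)
    then show ?thesis
      using w by (simp add: W_def Z.scale)
  qed
  moreover have "kact k w \<in> W" if k: "k \<in> K" and w: "w \<in> W" for k w
  proof -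
    interpret k: Vector_Spaces.linear smul smul "kact k"
      by (rule kact_linear[OF k])
    have "kact (neg_one N) (kact k w) = kact k (kact (neg_one N) w)"
      using kact_mult[OF z k] kact_mult[OF k z] neg_one_central[of k N] K k by auto
    then show ?thesis
      using w by (simp add: W_def k.scale)
  qed
  ultimately have "W = {0} \<or> W = UNIV"
    by (rule irreducible)
  moreover have "v \<in> W"
    using v by (simp add: W_def)
  ultimately have "W = UNIV"
    using v(1) by blast
  then show ?thesis
    unfolding W_def by blast
qed

section \<open>Comparison of the K-types occurring in one module\<close>

lemma ktypes_in_neg_one_eigenvector:
  assumes "\<sigma> \<in> ktypes_in (pair_K P) (pair_embed P) smul kact" "has_params (pair_factors P) \<sigma> ps"
  obtains v where "v \<noteq> 0"
    "kact (neg_one (pair_size P)) v = smul (parity_sign (parity (pair_factors P) ps)) v"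
proof -
  define z where "z = neg_one (sum_list (map factor_size (pair_factors P)))"
  from assms(1) obtain d \<rho> T x where \<sigma>: "\<sigma> \<in> ktypes (pair_K P)" "(d, \<rho>) \<in> \<sigma>"
    and scale: "\<forall>c. \<forall>x\<in>carrier_vec d. T (c \<cdot>\<^sub>v x) = smul c (T x)"
    and comm: "\<forall>k\<in>pair_K P. \<forall>x\<in>carrier_vec d. T (\<rho> k *\<^sub>v x) = kact (pair_embed P k) (T x)"
    and x: "x \<in> carrier_vec d" "T x \<noteq> 0"
    unfolding ktypes_in_def by blast
  have z: "z \<in> pair_K P" "pair_embed P z = neg_one (pair_size P)"
    using neg_one_compact_group pair_embed_neg_one by (simp_all add: z_def)
  have "\<rho> z *\<^sub>v x = parity_sign (parity (pair_factors P) ps) \<cdot>\<^sub>v x"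
    unfolding z_def has_params_scalar[OF \<sigma>(1) assms(2) \<sigma>(2)]
    using x(1) by (simp add: smult_mat_mult_vec)
  \<comment> \<open>The homomorphism \<open>T\<close> carries the scalar action on the K-type to the
    nonzero vector \<open>T x\<close>.\<close>
  then have "kact (neg_one (pair_size P)) (T x) = smul (parity_sign (parity (pair_factors P) ps)) (T x)"
    using bspec[OF comm z(1)] scale x(1) by (auto simp: z(2))
  then show thesis
    using that x(2) by blast
qed

theorem theorem2p1:
  fixes P :: classical_pair
    and smul :: "complex \<Rightarrow> 'v::ab_group_add \<Rightarrow> 'v"
    and act :: "complex mat \<times> complex mat \<Rightarrow> 'v \<Rightarrow> 'v"
    and kact :: "complex mat \<Rightarrow> 'v \<Rightarrow> 'v"
    and \<sigma>\<^sub>1 \<sigma>\<^sub>2 :: "mat_rep set"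
    and ps\<^sub>1 ps\<^sub>2 :: "ktype_param list"
  assumes "irreducible_gK_module smul (pair_size P) (pair_group P) (pair_embed P ` pair_K P) act kact"
    and "\<sigma>\<^sub>1 \<in> ktypes_in (pair_K P) (pair_embed P) smul kact"
    and "\<sigma>\<^sub>2 \<in> ktypes_in (pair_K P) (pair_embed P) smul kact"
    and "has_params (pair_factors P) \<sigma>\<^sub>1 ps\<^sub>1"
    and "has_params (pair_factors P) \<sigma>\<^sub>2 ps\<^sub>2"
  shows "parity (pair_factors P) ps\<^sub>1 = parity (pair_factors P) ps\<^sub>2"
proof -
  interpret irreducible_gK_module smul "pair_size P" "pair_group P" "pair_embed P ` pair_K P" act kact
    by (rule assms(1))
  obtain v where v: "v \<noteq> 0"
    "kact (neg_one (pair_size P)) v = smul (parity_sign (parity (pair_factors P) ps\<^sub>1)) v"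
    by (rule ktypes_in_neg_one_eigenvector[OF assms(2,4)])
  obtain w where w: "w \<noteq> 0"
    "kact (neg_one (pair_size P)) w = smul (parity_sign (parity (pair_factors P) ps\<^sub>2)) w"
    by (rule ktypes_in_neg_one_eigenvector[OF assms(3,5)])
  \<comment> \<open>The eigenvector \<open>v\<close> from the first K-type fixes the scalar on the
    whole module, hence on \<open>w\<close> from the second.\<close>
  have "kact (neg_one (pair_size P)) w = smul (parity_sign (parity (pair_factors P) ps\<^sub>1)) w"
    using pair_embed_carrier by (intro neg_one_scalar[OF _ neg_one_pair_K v]) blast
  then have "smul (parity_sign (parity (pair_factors P) ps\<^sub>1)) w =
      smul (parity_sign (parity (pair_factors P) ps\<^sub>2)) w"
    using w(2) by (rule trans[OF sym])
  then show ?thesis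
    using w(1) by (simp only: parity_sign_eq_iff scale_cancel_right simp_thms)
qed

end
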